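(* Let $k$ be a commutative field of characteristic $0$, and let $(\mathcal{A},d)$ be a commutative associative $k$-algebra with unit endowed with a derivation $d$ whose ring of constants $\ker(d)$ is exactly $k$. Let $\mathcal{C}\subset\mathcal{A}$ be a differential subfield (i.e. a subfield with $d(\mathcal{C})\subset\mathcal{C}$). Let $X$ be an alphabet (possibly infinite) and let $$M=\sum_{x\in X}u_x\,x\in \mathcal{C}\langle\!\langle X\rangle\!\rangle$$ be a homogeneous series of degree $1$ (with $u_x\in\mathcal{C}$). Suppose $S\in\mathcal{A}\langle\!\langle X\rangle\!\rangle$ satisfies $$\mathbf{d}(S)=MS,\qquad \langle S\mid 1_{X^*}\rangle=1 .$$ Then the following conditions are equivalent: (i) The family $(\langle S\mid w\rangle)_{w\in X^*}$ of coefficients of $S$ is linearly independent (free) over $\mathcal{C}$. (ii) The family $(\langle S\mid y\rangle)_{y\in X\cup\{1_{X^*}\}}$ is linearly independent over $\mathcal{C}$. (iii) For every $f\in\mathcal{C}$ and every finitely supported family $(\alpha_x)_{x\in X}$ of elements of $k$, if $d(f)=\sum_{x\in X}\alpha_x u_x$ then $\alpha_x=0$ for all $x\in X$. (iv) The family $(u_x)_{x\in X}$ is linearly independent over $k$ and $d(\mathcal{C})\cap\operatorname{span}_k\big((u_x)_{x\in X}\big)=\{0\}$.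
   Context: $X^*$ denotes the free monoid on $X$ with empty word $1_{X^*}$. For a commutative ring $R$, $R\langle\!\langle X\rangle\!\rangle$ is the algebra of all functions $X^*\to R$ (noncommutative formal power series, written $S=\sum_{w\in X^*}\langle S\mid w\rangle w$, with the Cauchy/concatenation product), and $R\langle X\rangle$ the subalgebra of finitely supported ones (noncommutative polynomials); the pairing is $\langle S\mid P\rangle=\sum_{w}\langle S\mid w\rangle\langle P\mid w\rangle$. The derivation $d$ is extended coefficientwise to $\mathcal{A}\langle\!\langle X\rangle\!\rangle$ by $\mathbf{d}(S)=\sum_{w\in X^*}d(\langle S\mid w\rangle)\,w$.
   Formalization: The differential subfield C is additionally assumed to contain k; otherwise (ii) does not imply (iii), e.g. k = R, A = R[[t]], C = Q, u_x = u_y = 1, with S having coefficients t at x and t + sqrt 2 at y. *)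

theory Defs
  imports Complex_Main
begin

locale differential_algebra = vector_space scale
  for scale :: "'k::field \<Rightarrow> 'a::comm_ring_1 \<Rightarrow> 'a" +
  fixes d :: "'a \<Rightarrow> 'a"
  assumes scale_mult_left: "scale c a * b = scale c (a * b)"
    and deriv_add: "d (a + b) = d a + d b"
    and deriv_scale: "d (scale c a) = scale c (d a)"
    and deriv_mult: "d (a * b) = d a * b + a * d b"

definition constants :: "('a::comm_ring_1 \<Rightarrow> 'a) \<Rightarrow> 'a set"
  where "constants d = {a. d a = 0}"

definition subfield_of_ring :: "'a::comm_ring_1 set \<Rightarrow> bool"
  where "subfield_of_ring C \<longleftrightarrow>
    0 \<in> C \<and> 1 \<in> C \<and>
    (\<forall>a\<in>C. \<forall>b\<in>C. a + b \<in> C \<and> a * b \<in> C) \<and>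
    (\<forall>a\<in>C. - a \<in> C) \<and>
    (\<forall>a\<in>C. a \<noteq> 0 \<longrightarrow> (\<exists>b\<in>C. a * b = 1))"

definition differential_subfield :: "('a::comm_ring_1 \<Rightarrow> 'a) \<Rightarrow> 'a set \<Rightarrow> bool"
  where "differential_subfield d C \<longleftrightarrow> subfield_of_ring C \<and> d ` C \<subseteq> C"

text \<open>
  Linear independence of the indexed family \<open>(v i)\<close>, \<open>i \<in> I\<close>, with scalars
  from the set \<open>K\<close> acting by \<open>scl\<close>. It concerns the family and not its range:
  a family with a repeated member is dependent.
\<close>

definition free_family ::
    "('s::zero \<Rightarrow> 'v::comm_monoid_add \<Rightarrow> 'v) \<Rightarrow> 's set \<Rightarrow> 'i set \<Rightarrow> ('i \<Rightarrow> 'v) \<Rightarrow> bool"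
  where "free_family scl K I v \<longleftrightarrow>
    (\<forall>c. (\<forall>i\<in>I. c i \<in> K) \<longrightarrow> finite {i\<in>I. c i \<noteq> 0} \<longrightarrow>
       (\<Sum>i\<in>{i\<in>I. c i \<noteq> 0}. scl (c i) (v i)) = 0 \<longrightarrow> (\<forall>i\<in>I. c i = 0))"

text \<open>
  The free monoid on \<open>X\<close> is \<open>lists X\<close>. A noncommutative series, i.e. a function
  from \<open>lists X\<close> to \<open>R\<close>, is represented by its extension by zero to all lists, so
  that equality of series is equality of functions.
\<close>

definition nc_series :: "'x set \<Rightarrow> 'a::zero set \<Rightarrow> ('x list \<Rightarrow> 'a) set"
  where "nc_series X R = {S. (\<forall>w\<in>lists X. S w \<in> R) \<and> (\<forall>w. w \<notin> lists X \<longrightarrow> S w = 0)}"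

definition nc_mult ::
    "('x list \<Rightarrow> 'a::comm_ring_1) \<Rightarrow> ('x list \<Rightarrow> 'a) \<Rightarrow> 'x list \<Rightarrow> 'a"
  where "nc_mult S T w = (\<Sum>(p, q)\<in>{(p, q). p @ q = w}. S p * T q)"

definition nc_deriv :: "('a \<Rightarrow> 'a) \<Rightarrow> ('x list \<Rightarrow> 'a) \<Rightarrow> 'x list \<Rightarrow> 'a"
  where "nc_deriv d S w = d (S w)"

text \<open>The homogeneous series of degree 1 with coefficient \<open>u x\<close> at each letter \<open>x \<in> X\<close>.\<close>

definition degree_one_series :: "'x set \<Rightarrow> ('x \<Rightarrow> 'a::zero) \<Rightarrow> 'x list \<Rightarrow> 'a"
  where "degree_one_series X u w =
    (case w of [x] \<Rightarrow> if x \<in> X then u x else 0 | _ \<Rightarrow> 0)"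

end

theory Submission
  imports Defs
begin

text \<open>
  Coefficientwise the equation reads \<open>d (S (x # v)) = u x * S v\<close>. Given a nontrivial relation
  \<open>(\<Sum>w. c w * S w) = 0\<close> whose longest words have length \<open>n\<close>, normalise one coefficient of
  length \<open>n\<close> to \<open>1\<close> and differentiate. The new relation has coefficients
  \<open>d (c v) + (\<Sum>x. c (x # v) * u x)\<close> and fewer words of length \<open>n\<close>, so if the original one was
  minimal the new one is trivial. Its vanishing in length \<open>n\<close> shows that the \<open>c w\<close> with
  \<open>length w = n\<close> are constants; its vanishing in length \<open>n - 1\<close> exhibits a nontrivial constant
  combination of the \<open>u x\<close> as a derivative. Conversely, if \<open>d f = (\<Sum>x. \<alpha> x * u x)\<close>, then
  \<open>f - (\<Sum>x. \<alpha> x * S [x])\<close> is a constant, which is a relation between \<open>1\<close> and the \<open>S [x]\<close>.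
\<close>

section \<open>Free families and spans of indexed families\<close>

lemma free_familyD:
  assumes "free_family scl K I v" "\<And>i. i \<in> I \<Longrightarrow> c i \<in> K" "finite {i\<in>I. c i \<noteq> 0}"
    "(\<Sum>i\<in>{i\<in>I. c i \<noteq> 0}. scl (c i) (v i)) = 0" "i \<in> I"
  shows "c i = 0"
  using assms unfolding free_family_def by blast

lemma free_family_subset:
  assumes free: "free_family scl K I v" and "J \<subseteq> I" and "0 \<in> K"
  shows "free_family scl K J v"
  unfolding free_family_def
proof (intro allI impI ballI)
  fix c j
  assume c: "\<forall>i\<in>J. c i \<in> K" "finite {i\<in>J. c i \<noteq> 0}"
      "(\<Sum>i\<in>{i\<in>J. c i \<noteq> 0}. scl (c i) (v i)) = 0" and j: "j \<in> J"
  define e where "e i = (if i \<in> J then c i else 0)" for i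
  have supp: "{i\<in>I. e i \<noteq> 0} = {i\<in>J. c i \<noteq> 0}"
    using \<open>J \<subseteq> I\<close> by (auto simp: e_def)
  have "(\<Sum>i\<in>{i\<in>I. e i \<noteq> 0}. scl (e i) (v i)) = (\<Sum>i\<in>{i\<in>J. c i \<noteq> 0}. scl (c i) (v i))"
    unfolding supp by (rule sum.cong) (auto simp: e_def)
  then have "e j = 0"
    using c supp j \<open>J \<subseteq> I\<close> \<open>0 \<in> K\<close>
    by (intro free_familyD[OF free, of e]) (auto simp: e_def)
  then show "c j = 0"
    using j by (simp add: e_def)
qed

lemma (in vector_space) sum_scale_mono_neutral:
  assumes "finite F" "{x\<in>X. \<alpha> x \<noteq> 0} \<subseteq> F" "F \<subseteq> X"
  shows "(\<Sum>x\<in>{x\<in>X. \<alpha> x \<noteq> 0}. scale (\<alpha> x) (u x)) = (\<Sum>x\<in>F. scale (\<alpha> x) (u x))"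
  using assms by (intro sum.mono_neutral_left) auto

lemma (in vector_space) span_imageE:
  assumes "y \<in> span (u ` X)"
  obtains \<alpha> where "finite {x\<in>X. \<alpha> x \<noteq> 0}" "y = (\<Sum>x\<in>{x\<in>X. \<alpha> x \<noteq> 0}. scale (\<alpha> x) (u x))"
proof -
  obtain t r where t: "finite t" "t \<subseteq> u ` X" and y: "y = (\<Sum>a\<in>t. scale (r a) a)"
    using assms unfolding span_explicit by blast
  \<comment> \<open>\<open>u\<close> may take the same value at several indices, so one index is
    selected for each vector of \<open>t\<close>; the scalars can then be transported to indices
    without double counting.\<close>
  obtain F where F: "F \<subseteq> X" "inj_on u F" "t = u ` F"
    using t(2) by (metis subset_image_inj)
  then have finF: "finite F"
    using t(1) finite_image_iff by blast
  define \<alpha> where "\<alpha> x = (if x \<in> F then r (u x) else 0)" for x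
  have sub: "{x\<in>X. \<alpha> x \<noteq> 0} \<subseteq> F"
    by (auto simp: \<alpha>_def)
  have "y = (\<Sum>x\<in>F. scale (\<alpha> x) (u x))"
    using F y by (simp add: sum.reindex \<alpha>_def)
  also have "\<dots> = (\<Sum>x\<in>{x\<in>X. \<alpha> x \<noteq> 0}. scale (\<alpha> x) (u x))"
    by (rule sum_scale_mono_neutral[symmetric]) (fact finF sub F(1))+
  finally show thesis
    by (rule that[OF finite_subset[OF sub finF]])
qed

section \<open>Elementary rules for derivations\<close>

context differential_algebra
begin

lemma deriv_zero [simp]: "d 0 = 0"
  using deriv_add[of 0 0] by simp

lemma deriv_one [simp]: "d 1 = 0"
  using deriv_mult[of 1 1] by simp

lemma deriv_minus: "d (- a) = - d a"
  using deriv_add[of a "- a"] by (simp add: eq_neg_iff_add_eq_0 add.commute)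

lemma deriv_diff: "d (a - b) = d a - d b"
  using deriv_add[of a "- b"] by (simp add: deriv_minus)

lemma deriv_sum: "d (\<Sum>i\<in>I. f i) = (\<Sum>i\<in>I. d (f i))"
  by (induction I rule: infinite_finite_induct) (simp_all add: deriv_add)

lemma scale_one_mult: "scale c 1 * a = scale c a"
  by (simp add: scale_mult_left)

end

text \<open>The equation for \<open>S\<close> enters in coefficient form, at words that begin with a
  letter of \<open>X\<close>. At the empty word it would only say \<open>d 1 = 0\<close>.\<close>

locale linear_word_system = differential_algebra scale d
  for scale :: "'k::field \<Rightarrow> 'a::comm_ring_1 \<Rightarrow> 'a" and d +
  fixes C :: "'a set" and X :: "'x set" and u :: "'x \<Rightarrow> 'a" and S :: "'x list \<Rightarrow> 'a"
  assumes constants_eq: "constants d = range (\<lambda>c. scale c 1)"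
    and subfield: "differential_subfield d C"
    and scalars_in: "range (\<lambda>c. scale c 1) \<subseteq> C"
    and u_in: "x \<in> X \<Longrightarrow> u x \<in> C"
    and S_Nil: "S [] = 1"
    and deriv_S_Cons: "x \<in> X \<Longrightarrow> d (S (x # v)) = u x * S v"
begin

text \<open>Condition (iii) of the theorem, serving as the hub: each of the other three conditions
  is shown equivalent to it.\<close>

definition no_primitive :: bool
  where "no_primitive \<longleftrightarrow>
    (\<forall>f\<in>C. \<forall>\<alpha>::'x \<Rightarrow> 'k. finite {x\<in>X. \<alpha> x \<noteq> 0} \<longrightarrow>
       d f = (\<Sum>x\<in>{x\<in>X. \<alpha> x \<noteq> 0}. scale (\<alpha> x) (u x)) \<longrightarrow> (\<forall>x\<in>X. \<alpha> x = 0))"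

lemma zero_in [simp]: "0 \<in> C"
  and one_in [simp]: "1 \<in> C"
  and add_in: "a \<in> C \<Longrightarrow> b \<in> C \<Longrightarrow> a + b \<in> C"
  and mult_in: "a \<in> C \<Longrightarrow> b \<in> C \<Longrightarrow> a * b \<in> C"
  and minus_in: "a \<in> C \<Longrightarrow> - a \<in> C"
  and deriv_in: "a \<in> C \<Longrightarrow> d a \<in> C"
  using subfield by (auto simp: differential_subfield_def subfield_of_ring_def)

lemma diff_in: "a \<in> C \<Longrightarrow> b \<in> C \<Longrightarrow> a - b \<in> C"
  using add_in[of a "- b"] minus_in[of b] by simp

lemma inverse_in:
  assumes "a \<in> C" "a \<noteq> 0"
  obtains b where "b \<in> C" "b * a = 1"
  using assms subfield
  by (auto simp: differential_subfield_def subfield_of_ring_def mult.commute)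

lemma sum_in: "(\<And>i. i \<in> I \<Longrightarrow> f i \<in> C) \<Longrightarrow> (\<Sum>i\<in>I. f i) \<in> C"
  by (induction I rule: infinite_finite_induct) (auto intro: add_in)

lemma constantE:
  assumes "d a = 0"
  obtains k where "a = scale k 1"
  using assms constants_eq unfolding constants_def by blast

lemma no_primitive_if_free_letters:
  assumes free: "free_family (*) C (insert [] ((\<lambda>x. [x]) ` X)) S"
  shows no_primitive
  unfolding no_primitive_def
proof (intro ballI allI impI)
  fix f and \<alpha> :: "'x \<Rightarrow> 'k" and x
  assume f: "f \<in> C" and fin: "finite {x\<in>X. \<alpha> x \<noteq> 0}" and x: "x \<in> X"
    and df: "d f = (\<Sum>x\<in>{x\<in>X. \<alpha> x \<noteq> 0}. scale (\<alpha> x) (u x))"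
  let ?F = "{x\<in>X. \<alpha> x \<noteq> 0}" and ?I = "insert [] ((\<lambda>x. [x]) ` X)"
  have "d (f - (\<Sum>x\<in>?F. scale (\<alpha> x) (S [x]))) = 0"
    by (simp add: deriv_diff deriv_sum deriv_scale df deriv_S_Cons S_Nil)
  then obtain k where k: "f - (\<Sum>x\<in>?F. scale (\<alpha> x) (S [x])) = scale k 1"
    by (rule constantE)
  \<comment> \<open>These are the coefficients of the relation that results from moving
    \<open>f\<close> to the other side: \<open>scale k 1 - f\<close> at the empty word and
    \<open>\<alpha> x\<close> at \<open>[x]\<close>. Values at longer words never enter.\<close>
  define c where "c w = (case w of [] \<Rightarrow> scale k 1 - f | y # _ \<Rightarrow> scale (\<alpha> y) 1)" for w :: "'x list"
  have sub: "{w\<in>?I. c w \<noteq> 0} \<subseteq> insert [] ((\<lambda>x. [x]) ` ?F)"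
    by (auto simp: c_def)
  \<comment> \<open>The coefficient at \<open>[]\<close> may vanish, so the support can be smaller
    than the index set on the right.\<close>
  have "(\<Sum>w\<in>{w\<in>?I. c w \<noteq> 0}. c w * S w) = (\<Sum>w\<in>insert [] ((\<lambda>x. [x]) ` ?F). c w * S w)"
    using fin sub by (intro sum.mono_neutral_left) auto
  also have "\<dots> = c [] + (\<Sum>x\<in>?F. scale (\<alpha> x) (S [x]))"
  proof (subst sum.insert)
    have "(\<Sum>w\<in>(\<lambda>x. [x]) ` ?F. c w * S w) = (\<Sum>x\<in>?F. c [x] * S [x])"
      by (subst sum.reindex) (auto simp: inj_on_def)
    then show "c [] * S [] + (\<Sum>w\<in>(\<lambda>x. [x]) ` ?F. c w * S w) =
        c [] + (\<Sum>x\<in>?F. scale (\<alpha> x) (S [x]))"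
      by (simp add: S_Nil c_def scale_one_mult)
  qed (use fin in auto)
  also have "\<dots> = 0"
    using k by (simp add: c_def algebra_simps)
  finally have sum0: "(\<Sum>w\<in>{w\<in>?I. c w \<noteq> 0}. c w * S w) = 0" .
  have cC: "c w \<in> C" if "w \<in> ?I" for w
    using f scalars_in by (cases w) (auto simp: c_def intro: diff_in)
  have "finite {w\<in>?I. c w \<noteq> 0}"
    using sub by (rule finite_subset) (use fin in simp)
  then have "c [x] = 0"
    using free_familyD[OF free, of c, OF cC] sum0 x by blast
  then show "\<alpha> x = 0"
    by (simp add: c_def)
qed

text \<open>Freeness of the \<open>u x\<close> is the case \<open>f = 0\<close> of
  \<open>no_primitive\<close>. Conversely, the intersection condition forces \<open>d f = 0\<close>,
  and freeness then kills the scalars.\<close>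

lemma no_primitive_iff:
  "no_primitive \<longleftrightarrow> free_family scale UNIV X u \<and> d ` C \<inter> span (u ` X) = {0}"
proof (intro iffI conjI)
  assume np: no_primitive
  show "free_family scale UNIV X u"
    unfolding free_family_def
  proof (intro allI impI)
    fix \<alpha>
    assume "finite {x\<in>X. \<alpha> x \<noteq> 0}" "(\<Sum>x\<in>{x\<in>X. \<alpha> x \<noteq> 0}. scale (\<alpha> x) (u x)) = 0"
    with bspec[OF np[unfolded no_primitive_def] zero_in, THEN spec, of \<alpha>]
    show "\<forall>x\<in>X. \<alpha> x = 0"
      by simp
  qed
  have "y = 0" if "y \<in> d ` C \<inter> span (u ` X)" for y
  proof -
    have "y \<in> span (u ` X)"
      using that by blast
    then obtain \<alpha> where "finite {x\<in>X. \<alpha> x \<noteq> 0}"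
      and y: "y = (\<Sum>x\<in>{x\<in>X. \<alpha> x \<noteq> 0}. scale (\<alpha> x) (u x))"
      by (rule span_imageE)
    with np that have "\<forall>x\<in>X. \<alpha> x = 0"
      unfolding no_primitive_def by blast
    then show ?thesis
      unfolding y by (intro sum.neutral) auto
  qed
  moreover have "0 \<in> d ` C \<inter> span (u ` X)"
    using span_zero by (auto intro: image_eqI[where x = 0])
  ultimately show "d ` C \<inter> span (u ` X) = {0}"
    by blast
next
  assume asm: "free_family scale UNIV X u \<and> d ` C \<inter> span (u ` X) = {0}"
  show no_primitive
    unfolding no_primitive_def
  proof (intro ballI allI impI)
    fix f and \<alpha> :: "'x \<Rightarrow> 'k" and x
    assume f: "f \<in> C" and fin: "finite {x\<in>X. \<alpha> x \<noteq> 0}" and x: "x \<in> X"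
      and df: "d f = (\<Sum>x\<in>{x\<in>X. \<alpha> x \<noteq> 0}. scale (\<alpha> x) (u x))"
    have "d f \<in> span (u ` X)"
      unfolding df by (intro span_sum span_scale span_base) auto
    with asm f have "d f = 0"
      by blast
    with df have "(\<Sum>x\<in>{x\<in>X. \<alpha> x \<noteq> 0}. scale (\<alpha> x) (u x)) = 0"
      by simp
    then show "\<alpha> x = 0"
      by (rule free_familyD[OF conjunct1[OF asm] UNIV_I fin _ x])
  qed
qed

section \<open>Linear relations between the coefficients of \<open>S\<close>, and their
  derivatives\<close>

definition relation :: "('x list \<Rightarrow> 'a) \<Rightarrow> bool"
  where "relation c \<longleftrightarrow> finite {w. c w \<noteq> 0} \<and> (\<forall>w. c w \<noteq> 0 \<longrightarrow> w \<in> lists X) \<and> range c \<subseteq> C \<and>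
    (\<Sum>w\<in>{w. c w \<noteq> 0}. c w * S w) = 0"

text \<open>Differentiating \<open>c w * S w\<close> contributes \<open>d (c w)\<close> at
  \<open>w\<close> and, if \<open>w = x # v\<close>, also \<open>c w * u x\<close> at
  \<open>v\<close>. For a relation \<open>c\<close> the sum only meets letters of \<open>X\<close>,
  since \<open>c\<close> vanishes outside \<open>lists X\<close>.\<close>

definition deriv_relation :: "('x list \<Rightarrow> 'a) \<Rightarrow> 'x list \<Rightarrow> 'a"
  where "deriv_relation c v = d (c v) + (\<Sum>x\<in>{x. c (x # v) \<noteq> 0}. c (x # v) * u x)"

lemma relation_mult:
  assumes "relation c" "g \<in> C"
  shows "relation (\<lambda>w. g * c w)"
proof -
  have sub: "{w. g * c w \<noteq> 0} \<subseteq> {w. c w \<noteq> 0}"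
    by auto
  have "(\<Sum>w\<in>{w. g * c w \<noteq> 0}. g * c w * S w) = (\<Sum>w\<in>{w. c w \<noteq> 0}. g * c w * S w)"
    using assms(1) sub by (intro sum.mono_neutral_left) (auto simp: relation_def)
  also have "\<dots> = g * (\<Sum>w\<in>{w. c w \<noteq> 0}. c w * S w)"
    by (simp add: sum_distrib_left mult.assoc)
  finally show ?thesis
    using assms sub by (auto simp: relation_def intro: finite_subset mult_in)
qed

text \<open>Apply \<open>d\<close> to the relation term by term. As
  \<open>d (S w) = u (hd w) * S (tl w)\<close> for the nonempty words of the support, the terms
  \<open>c w * d (S w)\<close> are regrouped along the fibres of \<open>tl\<close>.\<close>

lemma relation_deriv:
  assumes rel: "relation c"
  shows "relation (deriv_relation c)"
proof -
  define F where "F = {w. c w \<noteq> 0}"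
  \<comment> \<open>The empty word is set apart because it has no first letter; its term vanishes,
    as \<open>d (S []) = d 1 = 0\<close>.\<close>
  define G where "G = F - {[]}"
  define b where "b v = (\<Sum>x\<in>{x. c (x # v) \<noteq> 0}. c (x # v) * u x)" for v
  have finF: "finite F" and FX: "F \<subseteq> lists X" and cC: "\<And>w. c w \<in> C"
    and sum0: "(\<Sum>w\<in>F. c w * S w) = 0"
    using rel by (auto simp: relation_def F_def)
  have finG: "finite G"
    using finF by (simp add: G_def)
  have b_alt: "b v = (\<Sum>w\<in>{w\<in>G. tl w = v}. c w * u (hd w))" for v
    unfolding b_def
    by (rule sum.reindex_bij_witness[of _ hd "\<lambda>x. x # v"]) (auto simp: G_def F_def)
  have b0: "b v = 0" if "v \<notin> tl ` G" for v
    unfolding b_alt using that by (intro sum.neutral) auto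
  \<comment> \<open>The tail of a word in the support need not lie in the support, so both sums are
    moved to this common index set.\<close>
  have fin: "finite (F \<union> tl ` G)"
    using finF finG by simp
  have dr: "deriv_relation c v = d (c v) + b v" for v
    by (simp add: deriv_relation_def b_def)
  have sub: "{v. deriv_relation c v \<noteq> 0} \<subseteq> F \<union> tl ` G"
    using b0 by (auto simp: dr F_def)
  have GX: "tl w \<in> lists X \<and> hd w \<in> X" if "w \<in> G" for w
    using that FX by (cases w) (auto simp: G_def)
  have lists: "F \<union> tl ` G \<subseteq> lists X"
    using FX GX by auto
  have bC: "b v \<in> C" for v
    unfolding b_alt using GX cC by (intro sum_in mult_in u_in) auto
  have "0 = d (\<Sum>w\<in>F. c w * S w)"
    by (simp add: sum0)
  also have "\<dots> = (\<Sum>w\<in>F. d (c w) * S w) + (\<Sum>w\<in>F. c w * d (S w))"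
    by (simp add: deriv_sum deriv_mult sum.distrib)
  also have "(\<Sum>w\<in>F. d (c w) * S w) = (\<Sum>v\<in>F \<union> tl ` G. d (c v) * S v)"
    using fin by (intro sum.mono_neutral_left) (auto simp: F_def)
  also have "(\<Sum>w\<in>F. c w * d (S w)) = (\<Sum>w\<in>G. c w * d (S w))"
    using finF by (intro sum.mono_neutral_right) (auto simp: G_def S_Nil)
  also have "\<dots> = (\<Sum>w\<in>G. c w * u (hd w) * S (tl w))"
  proof (rule sum.cong)
    fix w assume w: "w \<in> G"
    then have "w = hd w # tl w"
      by (simp add: G_def)
    then have "d (S w) = u (hd w) * S (tl w)"
      using deriv_S_Cons[of "hd w" "tl w"] GX[OF w] by simp
    then show "c w * d (S w) = c w * u (hd w) * S (tl w)"
      by (simp add: mult.assoc)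
  qed simp
  also have "\<dots> = (\<Sum>v\<in>tl ` G. \<Sum>w\<in>{w\<in>G. tl w = v}. c w * u (hd w) * S (tl w))"
    using finG by (rule sum.image_gen)
  also have "\<dots> = (\<Sum>v\<in>tl ` G. b v * S v)"
    unfolding b_alt sum_distrib_right by (intro sum.cong) auto
  also have "\<dots> = (\<Sum>v\<in>F \<union> tl ` G. b v * S v)"
    using fin b0 by (intro sum.mono_neutral_left) auto
  also have "(\<Sum>v\<in>F \<union> tl ` G. d (c v) * S v) + (\<Sum>v\<in>F \<union> tl ` G. b v * S v) =
      (\<Sum>v\<in>F \<union> tl ` G. deriv_relation c v * S v)"
    by (simp add: dr sum.distrib distrib_right)
  also have "\<dots> = (\<Sum>v\<in>{v. deriv_relation c v \<noteq> 0}. deriv_relation c v * S v)"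
    using fin sub by (intro sum.mono_neutral_right) auto
  finally have "(\<Sum>v\<in>{v. deriv_relation c v \<noteq> 0}. deriv_relation c v * S v) = 0"
    by simp
  moreover have "deriv_relation c v \<in> C" for v
    unfolding dr by (intro add_in deriv_in cC bC)
  ultimately show ?thesis
    using finite_subset[OF sub fin] subset_trans[OF sub lists]
    unfolding relation_def by blast
qed

text \<open>The constants \<open>c (x # v)\<close> are scalars. If the new coefficient at
  \<open>v\<close> vanished, their combination of the \<open>u x\<close> would be the derivative of
  \<open>- c v\<close>, which lies in \<open>C\<close>, against \<open>no_primitive\<close>.\<close>

lemma deriv_relation_nontrivial:
  assumes np: no_primitive and rel: "relation c"
    and const: "\<And>x. d (c (x # v)) = 0" and nz: "c (y # v) \<noteq> 0"
  shows "deriv_relation c v \<noteq> 0"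
proof
  assume eq0: "deriv_relation c v = 0"
  have "\<forall>x. \<exists>k. c (x # v) = scale k 1"
    using const constantE by metis
  then obtain \<alpha> where \<alpha>: "\<And>x. c (x # v) = scale (\<alpha> x) 1"
    by metis
  have inX: "x \<in> X" if "c (x # v) \<noteq> 0" for x
    using rel that unfolding relation_def by (metis Cons_in_lists_iff)
  then have supp: "{x. c (x # v) \<noteq> 0} = {x\<in>X. \<alpha> x \<noteq> 0}"
    by (auto simp: \<alpha>)
  have "{x. c (x # v) \<noteq> 0} \<subseteq> hd ` {w. c w \<noteq> 0}"
    by force
  moreover have "finite (hd ` {w. c w \<noteq> 0})"
    using rel by (simp add: relation_def)
  ultimately have fin: "finite {x\<in>X. \<alpha> x \<noteq> 0}"
    unfolding supp by (rule finite_subset)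
  have "d (- c v) = - d (c v)"
    by (rule deriv_minus)
  also have "\<dots> = (\<Sum>x\<in>{x\<in>X. \<alpha> x \<noteq> 0}. c (x # v) * u x)"
    using eq0 unfolding deriv_relation_def supp by (rule minus_unique)
  also have "\<dots> = (\<Sum>x\<in>{x\<in>X. \<alpha> x \<noteq> 0}. scale (\<alpha> x) (u x))"
    by (simp only: \<alpha> scale_one_mult)
  finally have "d (- c v) = (\<Sum>x\<in>{x\<in>X. \<alpha> x \<noteq> 0}. scale (\<alpha> x) (u x))" .
  moreover have "- c v \<in> C"
    using rel unfolding relation_def by (intro minus_in) blast
  ultimately have "\<forall>x\<in>X. \<alpha> x = 0"
    using np fin unfolding no_primitive_def by blast
  with inX[OF nz] nz show False
    by (simp add: \<alpha>)
qed

text \<open>The minimality argument is a double induction: on a strict bound for the lengths of the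
  words in the support and, inside it, on the number of words of maximal admissible length.\<close>

lemma relation_trivial:
  assumes np: no_primitive
  shows "relation c \<Longrightarrow> (\<And>w. c w \<noteq> 0 \<Longrightarrow> length w < n) \<Longrightarrow> c = (\<lambda>_. 0)"
proof (induction n arbitrary: c)
  case 0
  then show ?case
    by auto
next
  case (Suc n)
  note shorter = Suc.IH
  from Suc.prems show ?case
  proof (induction "card {w. length w = n \<and> c w \<noteq> 0}" arbitrary: c rule: less_induct)
    case less
    have fin: "finite {w. length w = n \<and> c w \<noteq> 0}"
      using less.prems(1) by (auto simp: relation_def)
    show ?case
    proof (cases "\<exists>w. length w = n \<and> c w \<noteq> 0")
      case False
      then show ?thesis
        using less.prems shorter[of c] by (metis less_antisym)
    next
      case True
      then obtain w where w: "length w = n" "c w \<noteq> 0"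
        by blast
      then obtain g where g: "g \<in> C" "g * c w = 1"
        using less.prems(1) inverse_in[of "c w"] unfolding relation_def by blast
      \<comment> \<open>After normalisation the coefficient at \<open>w\<close> is \<open>1\<close>,
        whose derivative is \<open>0\<close>; thus \<open>w\<close> drops out of the top layer of
        the derived relation.\<close>
      define e where "e w = g * c w" for w
      have rel: "relation e"
        unfolding e_def using less.prems(1) g(1) by (rule relation_mult)
      have ew: "e w = 1"
        by (simp add: e_def g(2))
      have c0: "c v = 0" if "n < length v" for v
        using less.prems(2)[of v] that by linarith
      \<comment> \<open>From length \<open>n\<close> on, the sum in \<open>deriv_relation\<close>
        involves only words longer than \<open>n\<close>, where \<open>e\<close> vanishes.\<close>
      then have long: "deriv_relation e v = d (e v)" if "n \<le> length v" for v
        using that by (simp add: deriv_relation_def e_def)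
      have "card {v. length v = n \<and> deriv_relation e v \<noteq> 0} < card {w. length w = n \<and> c w \<noteq> 0}"
      proof (rule psubset_card_mono[OF fin])
        show "{v. length v = n \<and> deriv_relation e v \<noteq> 0} \<subset> {w. length w = n \<and> c w \<noteq> 0}"
        proof
          show "{v. length v = n \<and> deriv_relation e v \<noteq> 0} \<subseteq> {w. length w = n \<and> c w \<noteq> 0}"
            by (auto simp: long e_def)
          have "deriv_relation e w = 0"
            using long[of w] w(1) ew by simp
          with w show "{v. length v = n \<and> deriv_relation e v \<noteq> 0} \<noteq> {w. length w = n \<and> c w \<noteq> 0}"
            by blast
        qed
      qed
      moreover have "length v < Suc n" if "deriv_relation e v \<noteq> 0" for v
        using that long[of v] c0[of v] by (force simp: e_def)
      ultimately have triv: "deriv_relation e = (\<lambda>_. 0)"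
        by (intro less.hyps relation_deriv rel)
      show ?thesis
      proof (cases w)
        case Nil
        \<comment> \<open>Here \<open>n = 0\<close>, so the whole relation reads
          \<open>1 * S [] = 0\<close>, which is absurd.\<close>
        then have "{v. e v \<noteq> 0} = {[]}"
          using w(1) c0 ew by (fastforce simp: e_def)
        then have "e [] = 0"
          using rel by (simp add: relation_def S_Nil)
        with ew Nil show ?thesis
          by simp
      next
        case (Cons y v)
        \<comment> \<open>Every \<open>x # v\<close> has the same length \<open>n\<close> as
          \<open>w\<close>, so its derived coefficient is just \<open>d (e (x # v))\<close>, which
          is zero by \<open>triv\<close>.\<close>
        have "d (e (x # v)) = 0" for x
          using long[of "x # v"] w(1) Cons triv by simp
        then have "deriv_relation e v \<noteq> 0"
          using ew Cons by (intro deriv_relation_nontrivial[OF np rel, of v y]) auto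
        with triv show ?thesis
          by simp
      qed
    qed
  qed
qed

section \<open>The equivalences for the coefficients of \<open>S\<close>\<close>

lemma free_words_if_no_primitive:
  assumes np: no_primitive
  shows "free_family (*) C (lists X) S"
  unfolding free_family_def
proof (intro allI impI ballI)
  fix c w
  assume c: "\<forall>w\<in>lists X. c w \<in> C" "finite {w\<in>lists X. c w \<noteq> 0}"
    "(\<Sum>w\<in>{w\<in>lists X. c w \<noteq> 0}. c w * S w) = 0" and w: "w \<in> lists X"
  define e where "e v = (if v \<in> lists X then c v else 0)" for v
  have supp: "{v. e v \<noteq> 0} = {v\<in>lists X. c v \<noteq> 0}"
    by (auto simp: e_def)
  have "(\<Sum>v\<in>{v. e v \<noteq> 0}. e v * S v) = (\<Sum>v\<in>{v\<in>lists X. c v \<noteq> 0}. c v * S v)"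
    unfolding supp by (rule sum.cong) (auto simp: e_def)
  then have "relation e"
    using c supp by (auto simp: relation_def e_def)
  moreover have "\<exists>n. \<forall>v\<in>{v. e v \<noteq> 0}. length v < n"
    using c(2) supp finite_nat_set_iff_bounded[of "length ` {v. e v \<noteq> 0}"] by auto
  ultimately have "e = (\<lambda>_. 0)"
    using relation_trivial[OF np] by blast
  then show "c w = 0"
    using w unfolding e_def by metis
qed

text \<open>A cycle of implications: freeness over all words passes to the subfamily of
  \<open>[]\<close> and the letters, which gives \<open>no_primitive\<close>, which gives back
  freeness over all words.\<close>

lemma free_words_iff_no_primitive: "free_family (*) C (lists X) S \<longleftrightarrow> no_primitive"
  and free_letters_iff_no_primitive:
    "free_family (*) C (insert [] ((\<lambda>x. [x]) ` X)) S \<longleftrightarrow> no_primitive"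
proof -
  have "free_family (*) C (insert [] ((\<lambda>x. [x]) ` X)) S" if "free_family (*) C (lists X) S"
    using that by (rule free_family_subset) auto
  then show "free_family (*) C (lists X) S \<longleftrightarrow> no_primitive"
    and "free_family (*) C (insert [] ((\<lambda>x. [x]) ` X)) S \<longleftrightarrow> no_primitive"
    using no_primitive_if_free_letters free_words_if_no_primitive by blast+
qed

end

text \<open>Among the factorisations \<open>p @ q = x # v\<close> only \<open>p = [x]\<close> meets
  the support of the degree one series.\<close>

lemma nc_mult_degree_one_Cons:
  assumes "x \<in> X"
  shows "nc_mult (degree_one_series X u) S (x # v) = u x * S v"
proof -
  \<comment> \<open>Factorisations are given by their cut positions, so there are finitely many;
    otherwise the sum in \<open>nc_mult\<close> would default to zero.\<close>
  have "{(p, q). p @ q = x # v} \<subseteq> (\<lambda>i. (take i (x # v), drop i (x # v))) ` {..length (x # v)}"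
  proof clarify
    fix p q assume pq: "p @ q = x # v"
    show "(p, q) \<in> (\<lambda>i. (take i (x # v), drop i (x # v))) ` {..length (x # v)}"
      unfolding pq[symmetric] by (rule image_eqI[where x = "length p"]) simp_all
  qed
  then have "finite {(p, q). p @ q = x # v}"
    by (rule finite_subset) simp
  then have "nc_mult (degree_one_series X u) S (x # v) =
      (\<Sum>(p, q)\<in>{([x], v)}. degree_one_series X u p * S q)"
    unfolding nc_mult_def
    by (intro sum.mono_neutral_right)
      (auto simp: degree_one_series_def split: list.splits)
  then show ?thesis
    using assms by (simp add: degree_one_series_def)
qed

theorem theorem1:
  fixes scale :: "'k::field_char_0 \<Rightarrow> 'a::comm_ring_1 \<Rightarrow> 'a"
    and d :: "'a \<Rightarrow> 'a"
    and C :: "'a set"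
    and X :: "'x set"
    and u :: "'x \<Rightarrow> 'a"
    and M S :: "'x list \<Rightarrow> 'a"
  assumes "differential_algebra scale d"
    and "constants d = range (\<lambda>c. scale c 1)"
    and "differential_subfield d C"
    and "range (\<lambda>c. scale c 1) \<subseteq> C"
    and "\<And>x. x \<in> X \<Longrightarrow> u x \<in> C"
    and "M = degree_one_series X u"
    and "S \<in> nc_series X UNIV"
    and "nc_deriv d S = nc_mult M S"
    and "S [] = 1"
  shows "(free_family (*) C (lists X) S \<longleftrightarrow>
            free_family (*) C (insert [] ((\<lambda>x. [x]) ` X)) S) \<and>
         (free_family (*) C (lists X) S \<longleftrightarrow>
            (\<forall>f\<in>C. \<forall>\<alpha>::'x \<Rightarrow> 'k. finite {x\<in>X. \<alpha> x \<noteq> 0} \<longrightarrow>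
               d f = (\<Sum>x\<in>{x\<in>X. \<alpha> x \<noteq> 0}. scale (\<alpha> x) (u x)) \<longrightarrow> (\<forall>x\<in>X. \<alpha> x = 0))) \<and>
         (free_family (*) C (lists X) S \<longleftrightarrow>
            free_family scale UNIV X u \<and>
            d ` C \<inter> module.span scale (u ` X) = {0})"
proof -
  interpret differential_algebra scale d
    by fact
  interpret linear_word_system scale d C X u S
  proof
    show "d (S (x # v)) = u x * S v" if "x \<in> X" for x v
      using assms(8) nc_mult_degree_one_Cons[OF that, of u S v]
      unfolding nc_deriv_def assms(6) by metis
  qed (use assms in auto)
  show ?thesis
    using free_words_iff_no_primitive free_letters_iff_no_primitive no_primitive_iff
    unfolding no_primitive_def by blast
qed

end
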